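(* Let $R$ be a ring, let $T=[t_{i,j}]$ be a transitive matrix in $\mathrm{M}_n(R)$, and let $0=d_0<d_1<\cdots<d_{n-1}<d_n=m$ be a sequence of integers. Define an $m\times m$ matrix $\widehat{T}=[\widehat{t}_{p,q}]$ (the blow up of $T$) by $$\widehat{t}_{p,q}=t_{i,j}\quad\text{if } d_{i-1}<p\le d_i\text{ and }d_{j-1}<q\le d_j.$$ Then $\widehat{T}$ is a transitive matrix in $\mathrm{M}_m(R)$.
   Context: A ring means a not necessarily commutative ring with identity. $\mathrm{M}_n(R)$ is the ring of $n\times n$ matrices over $R$. A matrix $T=[t_{i,j}]\in\mathrm{M}_n(R)$ is transitive if $t_{i,i}=1$ and $t_{i,j}t_{j,k}=t_{i,k}$ for all $i,j,k\in\{1,\ldots,n\}$. *)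

theory Defs
  imports "Jordan_Normal_Form.Matrix"
begin

text \<open>
  The sort \<open>{ring, monoid_mult}\<close> is that of rings with identity, not necessarily commutative and,
  in contrast to the class \<open>ring_1\<close>, with the zero ring included. Matrix indices start at 0, so the
  entry \<open>A $$ (i, j)\<close> is the one usually written with indices \<open>i + 1\<close> and \<open>j + 1\<close>.
\<close>

definition transitive_mat :: "nat \<Rightarrow> 'a :: {ring, monoid_mult} mat \<Rightarrow> bool" where
  "transitive_mat n T \<longleftrightarrow> T \<in> carrier_mat n n \<and>
     (\<forall>i<n. T $$ (i, i) = 1) \<and>
     (\<forall>i<n. \<forall>j<n. \<forall>k<n. T $$ (i, j) * T $$ (j, k) = T $$ (i, k))"

text \<open>
  The sequence \<open>d\<close> is relevant only at \<open>0, \<dots>, n\<close>. With indices from 1, the index \<open>p\<close> lies in block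
  \<open>i\<close> if \<open>d (i - 1) < p \<le> d i\<close>; after shifting both \<open>p\<close> and \<open>i\<close> by one this
  reads \<open>d i \<le> p < d (i + 1)\<close>.
\<close>

definition block_index :: "nat \<Rightarrow> (nat \<Rightarrow> nat) \<Rightarrow> nat \<Rightarrow> nat" where
  "block_index n d p = (THE i. i < n \<and> d i \<le> p \<and> p < d (Suc i))"

definition blow_up :: "nat \<Rightarrow> (nat \<Rightarrow> nat) \<Rightarrow> 'a mat \<Rightarrow> 'a mat" where
  "blow_up n d T = mat (d n) (d n) (\<lambda>(p, q). T $$ (block_index n d p, block_index n d q))"

lemma block_index_unique:
  fixes d :: "nat \<Rightarrow> nat"
  assumes d0: "d 0 = 0" and less: "\<And>i. i < n \<Longrightarrow> d i < d (Suc i)" and p: "p < d n"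
  shows "\<exists>!i. i < n \<and> d i \<le> p \<and> p < d (Suc i)"
proof -
  have mono: "d i \<le> d j" if "i \<le> j" "j \<le> n" for i j
    using that
  proof (induction j rule: dec_induct)
    case base
    show ?case by simp
  next
    case (step j)
    then show ?case using less[of j] by simp
  qed
  have "\<exists>i<n. d i \<le> p \<and> p < d (Suc i)"
    using p
  proof (induction n)
    case 0
    then show ?case using d0 by simp
  next
    case (Suc n)
    then show ?case by (metis less_Suc_eq not_le)
  qed
  moreover have "i = j"
    if "i < n" "d i \<le> p" "p < d (Suc i)" "j < n" "d j \<le> p" "p < d (Suc j)" for i j
    using that mono[of "Suc i" j] mono[of "Suc j" i] by (cases i j rule: linorder_cases) auto
  ultimately show ?thesis by blast
qed

lemma block_index_eq:
  assumes "d 0 = 0" and "\<And>i. i < n \<Longrightarrow> d i < d (Suc i)"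
    and "i < n" "d i \<le> p" "p < d (Suc i)" "p < d n"
  shows "block_index n d p = i"
  unfolding block_index_def
  by (rule the1_equality[OF block_index_unique[OF assms(1,2,6)]]) (use assms in auto)

lemma index_blow_up:
  assumes "d 0 = 0" and "\<And>i. i < n \<Longrightarrow> d i < d (Suc i)"
    and "i < n" "d i \<le> p" "p < d (Suc i)" "p < d n"
    and "j < n" "d j \<le> q" "q < d (Suc j)" "q < d n"
  shows "blow_up n d T $$ (p, q) = T $$ (i, j)"
  using assms by (simp add: blow_up_def block_index_eq)

end

theory Submission
  imports Defs
begin

text \<open>With b = \<open>block_index n d\<close>, the blow up has entry
  \<open>T $$ (b p, b q)\<close> at \<open>(p, q)\<close>. The transitivity identities hold for all
  indices of \<open>T\<close>, so they pull back along b once b is known to map indices below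
  \<open>m\<close> to indices below \<open>n\<close>.\<close>

theorem proposition2p3:
  fixes T :: "'a :: {ring, monoid_mult} mat" and n m :: nat and d :: "nat \<Rightarrow> nat"
  assumes "n \<ge> 1"
    and "transitive_mat n T"
    and "d 0 = 0" and "\<And>i. i < n \<Longrightarrow> d i < d (Suc i)" and "d n = m"
  shows "transitive_mat m (blow_up n d T)"
proof -
  \<comment> \<open>A definite description satisfies its defining property only given unique
    existence, which \<open>block_index_unique\<close> supplies.\<close>
  have block: "block_index n d p < n" if "p < m" for p
    using theI'[OF block_index_unique[where d = d and n = n and p = p]] assms(3-5) that
    unfolding block_index_def by blast
  then show ?thesis
    using assms(2,5) unfolding transitive_mat_def blow_up_def by simp
qed

end
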